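(* Let $m\in\mathbb{N}$, $n\in\mathbb{N}_0$, $\boldsymbol{w}=(w_1,\ldots,w_m)\in\mathbb{R}^m$, $x_1,\ldots,x_m\in\mathbb{R}$, and $x=w_1x_1+\cdots+w_mx_m$. For $j=1,\ldots,m$ let $A^{(j)}(x)=(A^{(j)}_n(x))_{n\ge0}$ be a sequence of polynomials with $\sum_{n\ge0}A^{(j)}_n(x)\frac{z^n}{n!}=e^{xz}/\mathbb{E}e^{zY^{(j)}}$ for $|z|$ small, where $Y^{(j)}$ is a real random variable with $\mathbb{E}e^{s_j|Y^{(j)}|}<\infty$ for some $s_j>0$, and suppose $Y^{(1)},\ldots,Y^{(m)}$ are mutually independent. Then $$\sum_{j_1+\cdots+j_m=n}\binom{n}{j_1,\ldots,j_m}w_1^{j_1}\cdots w_m^{j_m}A^{(1)}_{j_1}(x_1)\cdots A^{(m)}_{j_m}(x_m)=\sum_{r=0}^n(-1)^rr!\,S_{\boldsymbol{w}\cdot\boldsymbol{Y}}(n,r;x)$$ $$=\sum_{r=0}^n\binom nr x^{n-r}\sum_{k=0}^r\binom{r+1}{k+1}(-1)^k\,\mathbb{E}\big(w_1S^{(1)}_k+\cdots+w_mS^{(m)}_k\big)^r.$$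
   Context: $\boldsymbol{w}\cdot\boldsymbol{Y}=w_1Y^{(1)}+\cdots+w_mY^{(m)}$. For each $j$, let $(Y^{(j)}_l)_{l\ge1}$ be independent copies of $Y^{(j)}$, with the sequences for $j=1,\ldots,m$ mutually independent, and $S^{(j)}_k=Y^{(j)}_1+\cdots+Y^{(j)}_k$, $S^{(j)}_0=0$. For a real random variable $X$ with $\mathbb{E}e^{s|X|}<\infty$ for some $s>0$, with $(X_i)$ independent copies of $X$ and $T_k=X_1+\cdots+X_k$ ($T_0=0$), the Stirling polynomials of the second kind associated to $X$ are $S_X(n,r;x)=\frac1{r!}\sum_{k=0}^r\binom rk(-1)^{r-k}\mathbb{E}(x+T_k)^n$, $r=0,\ldots,n$. Convention $0^0=1$. *)

theory Defs
  imports "HOL-Probability.Probability" "HOL-Computational_Algebra.Polynomial"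
begin

definition weak_compositions :: "nat \<Rightarrow> nat \<Rightarrow> (nat \<Rightarrow> nat) set" where
  "weak_compositions m n = {js \<in> {1..m} \<rightarrow>\<^sub>E UNIV. (\<Sum>j=1..m. js j) = n}"

lemma finite_weak_compositions: "finite (weak_compositions m n)"
proof (rule finite_subset)
  show "weak_compositions m n \<subseteq> {1..m} \<rightarrow>\<^sub>E {..n}"
  proof
    fix js assume js: "js \<in> weak_compositions m n"
    have "js j \<le> n" if "j \<in> {1..m}" for j
      using js member_le_sum[of j "{1..m}" js] that by (auto simp: weak_compositions_def)
    with js show "js \<in> {1..m} \<rightarrow>\<^sub>E {..n}"
      by (auto simp: weak_compositions_def PiE_iff)
  qed
qed (auto intro: finite_PiE)

definition multinomial :: "nat \<Rightarrow> nat \<Rightarrow> (nat \<Rightarrow> nat) \<Rightarrow> real" where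
  "multinomial m n js = fact n / (\<Prod>j=1..m. fact (js j))"

definition finite_exp_moment :: "'a measure \<Rightarrow> ('a \<Rightarrow> real) \<Rightarrow> bool" where
  "finite_exp_moment M X \<longleftrightarrow> (\<exists>s>0. integrable M (\<lambda>\<omega>. exp (s * \<bar>X \<omega>\<bar>)))"

text \<open>The generating function identity is only required for real \<open>z\<close>, in a neighbourhood of \<open>0\<close>
  that may depend on the point \<open>x\<close>.\<close>

definition appell_polys :: "'a measure \<Rightarrow> ('a \<Rightarrow> real) \<Rightarrow> (nat \<Rightarrow> real poly) \<Rightarrow> bool" where
  "appell_polys M Y A \<longleftrightarrow>
     (\<forall>x::real. \<forall>\<^sub>F z in nhds (0::real).
        (\<lambda>n. poly (A n) x * z ^ n / fact n) sums
          (exp (x * z) / (\<integral>\<omega>. exp (z * Y \<omega>) \<partial>M)))"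

text \<open>\<open>Z 1, Z 2, \<dots>\<close>, living on the probability space \<open>N\<close>, are independent copies of the
  random variable \<open>X\<close> on \<open>M\<close>.\<close>

definition indep_copies ::
    "'b measure \<Rightarrow> (nat \<Rightarrow> 'b \<Rightarrow> real) \<Rightarrow> 'a measure \<Rightarrow> ('a \<Rightarrow> real) \<Rightarrow> bool" where
  "indep_copies N Z M X \<longleftrightarrow>
     prob_space N \<and>
     prob_space.indep_vars N (\<lambda>_. borel) Z {1..} \<and>
     (\<forall>l\<ge>1. distr N borel (Z l) = distr M borel X)"

definition partial_sum :: "(nat \<Rightarrow> 'b \<Rightarrow> real) \<Rightarrow> nat \<Rightarrow> 'b \<Rightarrow> real" where
  "partial_sum Z k \<omega> = (\<Sum>l=1..k. Z l \<omega>)"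

text \<open>The Stirling polynomials depend only on the law of \<open>X\<close>. Independent copies of \<open>X\<close> are realised
  as the coordinate maps on the countable power of this law; \<open>stirling_poly_eq_copies\<close> below shows
  that every other realisation gives the same value.\<close>

definition iid_space :: "'a measure \<Rightarrow> ('a \<Rightarrow> real) \<Rightarrow> (nat \<Rightarrow> real) measure" where
  "iid_space M X = PiM {1..} (\<lambda>_. distr M borel X)"

definition stirling_poly :: "'a measure \<Rightarrow> ('a \<Rightarrow> real) \<Rightarrow> nat \<Rightarrow> nat \<Rightarrow> real \<Rightarrow> real" where
  "stirling_poly M X n r x =
     1 / fact r * (\<Sum>k=0..r. real (r choose k) * (-1) ^ (r - k) *
       (\<integral>\<omega>. (x + partial_sum (\<lambda>i \<omega>. \<omega> i) k \<omega>) ^ n \<partial>iid_space M X))"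

lemma stirling_poly_eq_copies:
  assumes "indep_copies N Z M X"
  shows "stirling_poly M X n r x =
     1 / fact r * (\<Sum>k=0..r. real (r choose k) * (-1) ^ (r - k) *
       (\<integral>\<omega>. (x + partial_sum Z k \<omega>) ^ n \<partial>N))"
proof -
  interpret N: prob_space N
    using assms by (simp add: indep_copies_def)
  have ind: "N.indep_vars (\<lambda>_. borel) Z {1..}"
    and law: "\<And>l. l \<ge> 1 \<Longrightarrow> distr N borel (Z l) = distr M borel X"
    using assms by (auto simp: indep_copies_def)
  have rv: "Z l \<in> borel_measurable N" if "l \<ge> 1" for l
    using ind that by (simp add: N.indep_vars_def)
  let ?Z = "\<lambda>\<omega>. \<lambda>l\<in>{1::nat..}. Z l \<omega>"
  let ?B = "PiM {1::nat..} (\<lambda>_. borel :: real measure)"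
  have Z: "?Z \<in> measurable N ?B"
    using rv by (intro measurable_restrict) auto
  have "distr N ?B ?Z = PiM {1..} (\<lambda>l. distr N borel (Z l))"
    using ind rv by (subst (asm) N.indep_vars_iff_distr_eq_PiM') auto
  also have "\<dots> = iid_space M X"
    unfolding iid_space_def using law by (intro PiM_cong) auto
  finally have eq: "iid_space M X = distr N ?B ?Z" ..
  have "(\<integral>\<omega>. (x + partial_sum (\<lambda>i \<omega>. \<omega> i) k \<omega>) ^ n \<partial>iid_space M X)
      = (\<integral>\<omega>. (x + partial_sum Z k \<omega>) ^ n \<partial>N)" for k
  proof -
    have "(\<lambda>\<omega>. (x + (\<Sum>l=1..k. \<omega> l)) ^ n) \<in> borel_measurable ?B"
      by (intro borel_measurable_power borel_measurable_add borel_measurable_sum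
          measurable_component_singleton) auto
    then show ?thesis
      unfolding eq partial_sum_def by (subst integral_distr[OF Z]) auto
  qed
  then show ?thesis
    unfolding stirling_poly_def by simp
qed

end

theory Submission
  imports Defs
begin

text \<open>Encode a random variable \<open>X\<close> by the formal power series
  \<open>a = \<Sum> E(X ^ n) z ^ n / n!\<close>, whose constant term is \<open>1\<close> and which turns independent
  sums into products. Under an exponential moment \<open>a\<close> is the expansion of \<open>E exp (z X)\<close>, so by
  uniqueness of expansions the Appell generating series of \<open>Y j\<close> is formally \<open>exp (x z) / a\<close>.
  For \<open>W = w \<cdot> Y\<close> all three expressions are \<open>n!\<close> times the \<open>n\<close>-th coefficient of
  \<open>exp (x z) / a\<close>: the first by multiplying the rescaled Appell series, the second by expanding
  \<open>1 / a\<close> as the geometric series in \<open>1 - a\<close>, the third from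
  \<open>\<Sum>k\<le>r. (r + 1 choose k + 1) (-1) ^ k a ^ k = (1 - (1 - a) ^ (r + 1)) / a\<close>;
  truncations are harmless because \<open>(1 - a) ^ (r + 1)\<close> has no terms of degree \<open>\<le> r\<close>.\<close>

section \<open>Coefficients of products of power series\<close>

text \<open>A composition \<open>js\<close> corresponds to the multiset in which \<open>j\<close>
  has multiplicity \<open>js j\<close>. This turns the sum over multisets in
  \<open>fps_prod_nth'\<close> into a sum over compositions.\<close>

lemma fps_prod_nth_weak_compositions:
  fixes G :: "nat \<Rightarrow> 'a::comm_ring_1 fps"
  shows "fps_nth (\<Prod>j=1..m. G j) n = (\<Sum>js\<in>weak_compositions m n. \<Prod>j=1..m. fps_nth (G j) (js j))"
proof -
  have count_rep: "count (\<Sum>j=1..m. replicate_mset (js j) j) i = (if i \<in> {1..m} then js i else 0)"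
    for js :: "nat \<Rightarrow> nat" and i
    by (simp add: count_sum)
  have set_rep: "set_mset (\<Sum>j=1..m. replicate_mset (js j) j) \<subseteq> {1..m}" for js :: "nat \<Rightarrow> nat"
    by (auto simp: set_mset_sum split: if_splits)
  have size_rep: "size (\<Sum>j=1..m. replicate_mset (js j) j) = (\<Sum>j=1..m. js j)" for js :: "nat \<Rightarrow> nat"
    by (induction m) simp_all
  have "(\<Sum>js\<in>weak_compositions m n. \<Prod>j=1..m. fps_nth (G j) (js j))
      = (\<Sum>X\<in>multisets_of_size {1..m} n. \<Prod>j=1..m. fps_nth (G j) (count X j))"
  proof (rule sum.reindex_bij_witness[where
        i = "\<lambda>X. restrict (count X) {1..m}" and j = "\<lambda>js. \<Sum>j=1..m. replicate_mset (js j) j"])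
    fix js assume js: "js \<in> weak_compositions m n"
    then have js_PiE: "js \<in> {1..m} \<rightarrow>\<^sub>E UNIV" and js_sum: "(\<Sum>j=1..m. js j) = n"
      by (simp_all add: weak_compositions_def)
    have "restrict (count (\<Sum>j=1..m. replicate_mset (js j) j)) {1..m} = restrict js {1..m}"
      by (rule restrict_ext) (simp only: count_rep if_True)
    also have "\<dots> = js"
      using js_PiE by (rule PiE_restrict)
    finally show "restrict (count (\<Sum>j=1..m. replicate_mset (js j) j)) {1..m} = js" .
    show "(\<Sum>j=1..m. replicate_mset (js j) j) \<in> multisets_of_size {1..m} n"
      unfolding multisets_of_size_def mem_Collect_eq size_rep js_sum by (intro conjI set_rep refl)
    show "(\<Prod>j=1..m. fps_nth (G j) (count (\<Sum>j=1..m. replicate_mset (js j) j) j))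
        = (\<Prod>j=1..m. fps_nth (G j) (js j))"
      by (rule prod.cong) (simp_all only: count_rep if_True)
  next
    fix X assume X: "X \<in> multisets_of_size {1..m} n"
    show "(\<Sum>j=1..m. replicate_mset (restrict (count X) {1..m} j) j) = X"
    proof (rule multiset_eqI)
      fix i
      show "count (\<Sum>j=1..m. replicate_mset (restrict (count X) {1..m} j) j) i = count X i"
        unfolding count_rep using X by (auto simp: multisets_of_size_def count_eq_zero_iff)
    qed
    have "size X = (\<Sum>j=1..m. count X j)"
      using X unfolding size_multiset_overloaded_eq
      by (intro sum.mono_neutral_left) (auto simp: multisets_of_size_def count_eq_zero_iff)
    then show "restrict (count X) {1..m} \<in> weak_compositions m n"
      using X by (simp add: weak_compositions_def multisets_of_size_def)
  qed
  then show ?thesis by (simp add: fps_prod_nth')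
qed

section \<open>Uniqueness of power series expansions\<close>

text \<open>Divide by the leading power of \<open>F\<close>: away from 0 the quotient function is
  still 0, while its value at 0 must be the leading coefficient. Continuity makes that coefficient
  vanish.\<close>

lemma has_fps_expansion_0_imp_eq_0:
  fixes F :: "'a::{real_normed_field,banach} fps"
  assumes "(\<lambda>_. 0) has_fps_expansion F"
  shows "F = 0"
proof (rule ccontr)
  assume "F \<noteq> 0"
  define k c where "k = subdegree F" and "c = fps_nth F k"
  have "c \<noteq> 0" using \<open>F \<noteq> 0\<close> by (simp add: c_def k_def)
  let ?g = "\<lambda>z::'a. if z = 0 then c else 0"
  have "?g has_fps_expansion fps_shift k F"
    using has_fps_expansion_shift[OF assms, of k c] by (simp add: k_def c_def cong: if_cong)
  then have "isCont ?g 0"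
    using has_fps_expansion_imp_continuous by blast
  moreover have "?g \<midarrow>0\<rightarrow> 0"
    by (rule Lim_transform_eventually[OF tendsto_const]) (auto simp: eventually_at_filter)
  ultimately have "c = 0"
    using LIM_unique by (fastforce simp: isCont_def)
  with \<open>c \<noteq> 0\<close> show False by simp
qed

lemma has_fps_expansion_unique:
  fixes F G :: "'a::{real_normed_field,banach} fps"
  assumes "f has_fps_expansion F" "f has_fps_expansion G"
  shows "F = G"
proof -
  have "(\<lambda>_. 0) has_fps_expansion F - G"
    using has_fps_expansion_diff[OF assms] by (simp only: diff_self)
  then have "F - G = 0" by (rule has_fps_expansion_0_imp_eq_0)
  then show ?thesis by simp
qed

lemma has_fps_expansionI_sums:
  fixes f :: "real \<Rightarrow> real"
  assumes "\<forall>\<^sub>F z in nhds 0. (\<lambda>n. fps_nth F n * z ^ n) sums f z"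
  shows "f has_fps_expansion F"
proof -
  obtain d where d: "d > 0" "\<And>z. \<bar>z\<bar> < d \<Longrightarrow> (\<lambda>n. fps_nth F n * z ^ n) sums f z"
    using assms by (auto simp: eventually_nhds_metric dist_norm)
  \<comment> \<open>Convergence at the single nonzero point \<open>d / 2\<close> already makes the
    radius positive.\<close>
  have "ereal (norm (d / 2)) \<le> fps_conv_radius F"
    unfolding fps_conv_radius_def using d by (intro conv_radius_geI sums_summable[OF d(2)]) auto
  moreover have "0 < ereal (norm (d / 2))" using \<open>d > 0\<close> by simp
  ultimately have "fps_conv_radius F > 0" by (rule less_le_trans[rotated])
  moreover have "\<forall>\<^sub>F z in nhds 0. eval_fps F z = f z"
    using assms by eventually_elim (simp add: eval_fps_def sums_iff)
  ultimately show ?thesis by (simp add: has_fps_expansion_def)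
qed

section \<open>Moment series and independence\<close>

text \<open>For formal series the existence of moments is enough, and it passes easily to multiples
  and independent sums. Exponential moments serve to obtain it and to relate series to
  functions.\<close>

definition all_moments :: "'a measure \<Rightarrow> ('a \<Rightarrow> real) \<Rightarrow> bool" where
  "all_moments M X \<longleftrightarrow> (\<forall>k. integrable M (\<lambda>\<omega>. X \<omega> ^ k))"

definition moment_fps :: "'a measure \<Rightarrow> ('a \<Rightarrow> real) \<Rightarrow> real fps" where
  "moment_fps M X = Abs_fps (\<lambda>n. (\<integral>\<omega>. X \<omega> ^ n \<partial>M) / fact n)"

lemma moment_fps_nth: "fps_nth (moment_fps M X) n = (\<integral>\<omega>. X \<omega> ^ n \<partial>M) / fact n"
  by (simp add: moment_fps_def)

lemma integral_power_eq_moment_fps: "(\<integral>\<omega>. X \<omega> ^ n \<partial>M) = fact n * fps_nth (moment_fps M X) n"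
  by (simp add: moment_fps_nth)

lemma all_moments_measurable:
  assumes "all_moments M X"
  shows "X \<in> borel_measurable M"
proof -
  have "integrable M (\<lambda>\<omega>. X \<omega> ^ 1)"
    using assms unfolding all_moments_def by (rule spec)
  then show ?thesis by simp
qed

lemma (in prob_space) moment_fps_const: "moment_fps M (\<lambda>_. c) = fps_exp c"
  by (intro fps_ext) (simp add: moment_fps_nth prob_space)

lemma (in prob_space) moment_fps_0: "fps_nth (moment_fps M X) 0 = 1"
  by (simp add: moment_fps_nth prob_space)

lemma moment_fps_cmult:
  "moment_fps M (\<lambda>\<omega>. c * X \<omega>) = moment_fps M X oo (fps_const c * fps_X)"
  by (intro fps_ext) (simp add: moment_fps_nth fps_nth_compose_linear power_mult_distrib)

lemma all_moments_cmult: "all_moments M X \<Longrightarrow> all_moments M (\<lambda>\<omega>. c * X \<omega>)"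
  by (auto simp: all_moments_def power_mult_distrib)

text \<open>After division by \<open>fact n\<close>, the binomial expansion of the moments is a
  Cauchy product. Only the factorisation of mixed moments enters, so this covers independent pairs
  as well as the addition of a constant.\<close>

lemma moment_fps_add_uncorrelated:
  assumes int: "\<And>i j. integrable M (\<lambda>\<omega>. X \<omega> ^ i * Y \<omega> ^ j)"
    and eq: "\<And>i j. (\<integral>\<omega>. X \<omega> ^ i * Y \<omega> ^ j \<partial>M) = (\<integral>\<omega>. X \<omega> ^ i \<partial>M) * (\<integral>\<omega>. Y \<omega> ^ j \<partial>M)"
  shows "all_moments M (\<lambda>\<omega>. X \<omega> + Y \<omega>)"
    and "moment_fps M (\<lambda>\<omega>. X \<omega> + Y \<omega>) = moment_fps M X * moment_fps M Y"
proof -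
  have expand: "(X \<omega> + Y \<omega>) ^ n = (\<Sum>i\<le>n. of_nat (n choose i) * (X \<omega> ^ i * Y \<omega> ^ (n - i)))" for n \<omega>
    by (simp add: binomial_ring mult.assoc)
  show "all_moments M (\<lambda>\<omega>. X \<omega> + Y \<omega>)"
    unfolding all_moments_def expand using int by auto
  show "moment_fps M (\<lambda>\<omega>. X \<omega> + Y \<omega>) = moment_fps M X * moment_fps M Y"
  proof (rule fps_ext)
    fix n
    have "(\<integral>\<omega>. (X \<omega> + Y \<omega>) ^ n \<partial>M)
        = (\<Sum>i\<le>n. of_nat (n choose i) * ((\<integral>\<omega>. X \<omega> ^ i \<partial>M) * (\<integral>\<omega>. Y \<omega> ^ (n - i) \<partial>M)))"
      unfolding expand using int by (simp add: eq)
    then show "fps_nth (moment_fps M (\<lambda>\<omega>. X \<omega> + Y \<omega>)) n = fps_nth (moment_fps M X * moment_fps M Y) n"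
      by (simp add: moment_fps_nth fps_mult_nth atLeast0AtMost sum_divide_distrib binomial_fact)
  qed
qed

context prob_space
begin

lemma
  assumes ind: "indep_var borel X borel Y" and "all_moments M X" "all_moments M Y"
  shows all_moments_add_indep: "all_moments M (\<lambda>\<omega>. X \<omega> + Y \<omega>)"
    and moment_fps_add_indep: "moment_fps M (\<lambda>\<omega>. X \<omega> + Y \<omega>) = moment_fps M X * moment_fps M Y"
proof -
  have indp: "indep_var borel (\<lambda>\<omega>. X \<omega> ^ i) borel (\<lambda>\<omega>. Y \<omega> ^ j)" for i j
    using indep_var_compose[OF ind, of "\<lambda>x. x ^ i" borel "\<lambda>x. x ^ j" borel] by (simp add: comp_def)
  have "integrable M (\<lambda>\<omega>. X \<omega> ^ i * Y \<omega> ^ j)"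
    "(\<integral>\<omega>. X \<omega> ^ i * Y \<omega> ^ j \<partial>M) = (\<integral>\<omega>. X \<omega> ^ i \<partial>M) * (\<integral>\<omega>. Y \<omega> ^ j \<partial>M)" for i j
    using assms indep_var_integrable[OF indp] indep_var_lebesgue_integral[OF indp]
    by (auto simp: all_moments_def)
  from moment_fps_add_uncorrelated[OF this]
  show "all_moments M (\<lambda>\<omega>. X \<omega> + Y \<omega>)"
    "moment_fps M (\<lambda>\<omega>. X \<omega> + Y \<omega>) = moment_fps M X * moment_fps M Y" .
qed

lemma moment_fps_shift:
  assumes "all_moments M X"
  shows "moment_fps M (\<lambda>\<omega>. x + X \<omega>) = fps_exp x * moment_fps M X"
proof -
  have "moment_fps M (\<lambda>\<omega>. x + X \<omega>) = moment_fps M (\<lambda>_. x) * moment_fps M X"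
    by (rule moment_fps_add_uncorrelated) (use assms in \<open>simp_all add: all_moments_def prob_space\<close>)
  then show ?thesis by (simp add: moment_fps_const)
qed

lemma
  assumes "finite I" "indep_vars (\<lambda>_. borel) X I" "\<And>i. i \<in> I \<Longrightarrow> all_moments M (X i)"
  shows all_moments_sum_indep: "all_moments M (\<lambda>\<omega>. \<Sum>i\<in>I. X i \<omega>)"
    and moment_fps_sum_indep: "moment_fps M (\<lambda>\<omega>. \<Sum>i\<in>I. X i \<omega>) = (\<Prod>i\<in>I. moment_fps M (X i))"
proof -
  have "all_moments M (\<lambda>\<omega>. \<Sum>i\<in>I. X i \<omega>) \<and>
    moment_fps M (\<lambda>\<omega>. \<Sum>i\<in>I. X i \<omega>) = (\<Prod>i\<in>I. moment_fps M (X i))"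
    using assms
  proof (induction I rule: finite_induct)
    case empty
    then show ?case by (simp add: moment_fps_const) (simp add: all_moments_def)
  next
    case (insert i I)
    have "indep_var borel (X i) borel (\<lambda>\<omega>. \<Sum>i\<in>I. X i \<omega>)"
      using insert by (intro indep_vars_sum) auto
    moreover have "indep_vars (\<lambda>_. borel) X I"
      using insert.prems(1) by (rule indep_vars_subset) auto
    ultimately show ?case
      using insert all_moments_add_indep moment_fps_add_indep by simp
  qed
  then show "all_moments M (\<lambda>\<omega>. \<Sum>i\<in>I. X i \<omega>)"
    "moment_fps M (\<lambda>\<omega>. \<Sum>i\<in>I. X i \<omega>) = (\<Prod>i\<in>I. moment_fps M (X i))" by auto
qed

end

text \<open>The copies live on another space than the original variable; their moments are brought
  back through the common law.\<close>

lemma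
  assumes "X \<in> borel_measurable M" "Y \<in> borel_measurable N" "distr M borel X = distr N borel Y"
  shows all_moments_cong_distr: "all_moments M X \<longleftrightarrow> all_moments N Y"
    and moment_fps_cong_distr: "moment_fps M X = moment_fps N Y"
proof -
  have "integrable M (\<lambda>\<omega>. X \<omega> ^ k) \<longleftrightarrow> integrable N (\<lambda>\<omega>. Y \<omega> ^ k)" for k
    using integrable_distr_eq[OF assms(1), of "\<lambda>x. x ^ k"] integrable_distr_eq[OF assms(2), of "\<lambda>x. x ^ k"] assms(3)
    by simp
  then show "all_moments M X \<longleftrightarrow> all_moments N Y" by (simp add: all_moments_def)
  have "(\<integral>\<omega>. X \<omega> ^ k \<partial>M) = (\<integral>\<omega>. Y \<omega> ^ k \<partial>N)" for k
    using integral_distr[OF assms(1), of "\<lambda>x. x ^ k"] integral_distr[OF assms(2), of "\<lambda>x. x ^ k"] assms(3)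
    by simp
  then show "moment_fps M X = moment_fps N Y" by (simp add: moment_fps_def)
qed

section \<open>Sums of independent copies\<close>

text \<open>Each of the \<open>k\<close> independent summands contributes the same factor, since
  copies share the law of \<open>X\<close>. From here on, sums of copies are handled as powers of
  one series.\<close>

lemma
  assumes copies: "indep_copies N Z M X" and X: "all_moments M X"
  shows all_moments_partial_sum: "all_moments N (partial_sum Z k)"
    and moment_fps_partial_sum: "moment_fps N (partial_sum Z k) = moment_fps M X ^ k"
proof -
  interpret N: prob_space N using copies by (simp add: indep_copies_def)
  have ind: "N.indep_vars (\<lambda>_. borel) Z {1..}"
    and law: "\<And>l. l \<ge> 1 \<Longrightarrow> distr N borel (Z l) = distr M borel X"
    using copies by (auto simp: indep_copies_def)
  have rv: "Z l \<in> borel_measurable N" if "l \<ge> 1" for l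
    using ind that by (simp add: N.indep_vars_def)
  have "all_moments N (Z l)" "moment_fps N (Z l) = moment_fps M X" if "l \<ge> 1" for l
    using all_moments_cong_distr[OF rv all_moments_measurable law]
      moment_fps_cong_distr[OF rv all_moments_measurable law] X that by auto
  then show "all_moments N (partial_sum Z k)" "moment_fps N (partial_sum Z k) = moment_fps M X ^ k"
    unfolding partial_sum_def
    using N.all_moments_sum_indep[of "{1..k}" Z] N.moment_fps_sum_indep[of "{1..k}" Z]
      N.indep_vars_subset[OF ind, of "{1..k}"] by auto
qed

lemma indep_copies_iid_space:
  assumes "prob_space M" "X \<in> borel_measurable M"
  shows "indep_copies (iid_space M X) (\<lambda>i \<omega>. \<omega> i) M X"
proof -
  let ?D = "distr M borel X"
  interpret D: prob_space ?D using assms by (intro prob_space.prob_space_distr)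
  interpret product_prob_space "\<lambda>_. ?D" "{1::nat..}"
    by unfold_locales
  interpret Q: prob_space "iid_space M X" unfolding iid_space_def by (rule P.prob_space_axioms)
  have law: "distr (iid_space M X) borel (\<lambda>\<omega>. \<omega> l) = ?D" if "l \<ge> 1" for l
    using distr_PiM_component[of "{1..}" "\<lambda>_. ?D" l] D.prob_space_axioms that
    by (simp add: iid_space_def cong: distr_cong)
  have rv: "(\<lambda>\<omega>. \<omega> l) \<in> borel_measurable (iid_space M X)" if "l \<ge> 1" for l
    unfolding iid_space_def using that measurable_component_singleton[of l "{1..}" "\<lambda>_. ?D"] by simp
  \<comment> \<open>On the product space, restricting to the index set is the identity, so the joint
    law of the coordinates is the product measure itself; this is the independence
    criterion.\<close>
  have "distr (iid_space M X) (PiM {1..} (\<lambda>_. borel)) (\<lambda>\<omega>. \<lambda>i\<in>{1..}. \<omega> i)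
      = distr (iid_space M X) (iid_space M X) (\<lambda>\<omega>. \<omega>)"
    by (intro distr_cong) (auto simp: iid_space_def space_PiM PiE_restrict intro!: sets_PiM_cong)
  also have "\<dots> = PiM {1..} (\<lambda>l. distr (iid_space M X) borel (\<lambda>\<omega>. \<omega> l))"
    unfolding distr_id by (subst (1) iid_space_def) (intro PiM_cong, auto simp: law)
  finally have "Q.indep_vars (\<lambda>_. borel) (\<lambda>i \<omega>. \<omega> i) {1..}"
    by (subst Q.indep_vars_iff_distr_eq_PiM') (use rv in auto)
  with law Q.prob_space_axioms show ?thesis by (auto simp: indep_copies_def)
qed

section \<open>Exponential moments and Appell generating functions\<close>

text \<open>Everything is dominated by \<open>exp (s * \<bar>X \<omega>\<bar>)\<close>: a single
  term of its series bounds a power of \<open>X\<close>, and the partial sums control the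
  exponential series of \<open>z * X \<omega>\<close> for \<open>\<bar>z\<bar> < s\<close>, so sum
  and integral may be exchanged.\<close>

lemma
  assumes meas: "X \<in> borel_measurable M" and fin: "finite_exp_moment M X"
  shows all_moments_finite_exp_moment: "all_moments M X"
    and mgf_has_fps_expansion: "(\<lambda>z. \<integral>\<omega>. exp (z * X \<omega>) \<partial>M) has_fps_expansion moment_fps M X"
proof -
  obtain s where s: "s > 0" and int: "integrable M (\<lambda>\<omega>. exp (s * \<bar>X \<omega>\<bar>))"
    using fin by (auto simp: finite_exp_moment_def)
  have partial: "(\<Sum>k<n. (s * \<bar>y\<bar>) ^ k / fact k) \<le> exp (s * \<bar>y\<bar>)" for n and y :: real
    using s sum_le_suminf[OF summable_exp_generic, of "{..<n}" "s * \<bar>y\<bar>"]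
    by (simp add: exp_def divide_inverse mult.commute)
  have summand: "(s * \<bar>y\<bar>) ^ k / fact k \<le> exp (s * \<bar>y\<bar>)" for k and y :: real
  proof -
    have "(s * \<bar>y\<bar>) ^ k / fact k \<le> (\<Sum>k<Suc k. (s * \<bar>y\<bar>) ^ k / fact k)"
      using s by (intro member_le_sum) auto
    with partial[of y "Suc k"] show ?thesis by linarith
  qed
  show mom: "all_moments M X"
    unfolding all_moments_def
  proof
    fix k
    \<comment> \<open>The factor \<open>fact k / s ^ k\<close> comes from solving
      \<open>summand\<close> for the \<open>k\<close>-th power.\<close>
    have "integrable M (\<lambda>\<omega>. fact k / s ^ k * exp (s * \<bar>X \<omega>\<bar>))" using int by simp
    then show "integrable M (\<lambda>\<omega>. X \<omega> ^ k)"
    proof (rule Bochner_Integration.integrable_bound)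
      show "(\<lambda>\<omega>. X \<omega> ^ k) \<in> borel_measurable M" using meas by measurable
      show "AE \<omega> in M. norm (X \<omega> ^ k) \<le> norm (fact k / s ^ k * exp (s * \<bar>X \<omega>\<bar>))"
        using summand[of _ k] s by (auto simp: power_abs power_mult_distrib field_simps)
    qed
  qed
  have "(\<lambda>n. fps_nth (moment_fps M X) n * z ^ n) sums (\<integral>\<omega>. exp (z * X \<omega>) \<partial>M)" if z: "\<bar>z\<bar> < s" for z
  proof -
    let ?f = "\<lambda>n \<omega>. X \<omega> ^ n / fact n * z ^ n"
    have f: "integrable M (?f n)" for n using mom by (simp add: all_moments_def)
    have norm_f: "norm (?f n \<omega>) \<le> (s * \<bar>X \<omega>\<bar>) ^ n / fact n" for n \<omega>
    proof -
      have "\<bar>X \<omega>\<bar> ^ n * \<bar>z\<bar> ^ n \<le> \<bar>X \<omega>\<bar> ^ n * s ^ n"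
        using z by (intro mult_left_mono power_mono) auto
      then show ?thesis
        by (simp add: abs_mult power_abs power_mult_distrib divide_right_mono mult.commute)
    qed
    have sums: "(\<lambda>n. ?f n \<omega>) sums exp (z * X \<omega>)" for \<omega>
      using exp_converges[of "z * X \<omega>"] by (simp add: power_mult_distrib divide_inverse mult_ac)
    have "(\<lambda>n. integral\<^sup>L M (?f n)) sums (\<integral>\<omega>. (\<Sum>n. ?f n \<omega>) \<partial>M)"
    proof (rule sums_integral[OF f])
      have "summable (\<lambda>n. norm (?f n \<omega>))" for \<omega>
        using summable_norm_exp[of "z * X \<omega>"] by (simp add: power_mult_distrib divide_inverse mult_ac abs_mult)
      then show "AE \<omega> in M. summable (\<lambda>n. norm (?f n \<omega>))" by simp
      show "summable (\<lambda>n. \<integral>\<omega>. norm (?f n \<omega>) \<partial>M)"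
      proof (rule bounded_imp_summable)
        fix n
        \<comment> \<open>The integrals of the norms are nonnegative, so a bound on their partial
          sums that is uniform in \<open>n\<close> gives summability.\<close>
        have "(\<Sum>k\<le>n. \<integral>\<omega>. norm (?f k \<omega>) \<partial>M) = (\<integral>\<omega>. (\<Sum>k\<le>n. norm (?f k \<omega>)) \<partial>M)"
          using f by (intro Bochner_Integration.integral_sum[symmetric] integrable_norm) auto
        also have "\<dots> \<le> (\<integral>\<omega>. exp (s * \<bar>X \<omega>\<bar>) \<partial>M)"
        proof (intro integral_mono int Bochner_Integration.integrable_sum integrable_norm f)
          fix \<omega>
          have "(\<Sum>k\<le>n. norm (?f k \<omega>)) \<le> (\<Sum>k<Suc n. (s * \<bar>X \<omega>\<bar>) ^ k / fact k)"
          unfolding lessThan_Suc_atMost by (intro sum_mono norm_f)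
          with partial show "(\<Sum>k\<le>n. norm (?f k \<omega>)) \<le> exp (s * \<bar>X \<omega>\<bar>)"
            by (rule order.trans[rotated])
        qed
        finally show "(\<Sum>k\<le>n. \<integral>\<omega>. norm (?f k \<omega>) \<partial>M) \<le> (\<integral>\<omega>. exp (s * \<bar>X \<omega>\<bar>) \<partial>M)" .
      qed auto
    qed
    then show ?thesis
      using sums by (simp add: moment_fps_nth sums_iff)
  qed
  with s show "(\<lambda>z. \<integral>\<omega>. exp (z * X \<omega>) \<partial>M) has_fps_expansion moment_fps M X"
    by (intro has_fps_expansionI_sums) (auto simp: eventually_nhds_metric dist_norm)
qed

text \<open>Near 0 the two functions multiply to \<open>exp (x * z)\<close>, and uniqueness of
  expansions carries this over to the formal series.\<close>

lemma appell_polys_mult_moment_fps: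
  assumes "prob_space M" "X \<in> borel_measurable M" "finite_exp_moment M X" "appell_polys M X A"
  shows "Abs_fps (\<lambda>n. poly (A n) x / fact n) * moment_fps M X = fps_exp x"
proof -
  let ?m = "\<lambda>z. \<integral>\<omega>. exp (z * X \<omega>) \<partial>M"
  have mgf: "?m has_fps_expansion moment_fps M X"
    using assms by (intro mgf_has_fps_expansion)
  interpret prob_space M by fact
  have "(\<lambda>z. exp (x * z) / ?m z) has_fps_expansion Abs_fps (\<lambda>n. poly (A n) x / fact n)"
    using assms(4) by (intro has_fps_expansionI_sums) (simp add: appell_polys_def)
  from has_fps_expansion_mult[OF this mgf]
  have prod: "(\<lambda>z. exp (x * z) / ?m z * ?m z) has_fps_expansion
      Abs_fps (\<lambda>n. poly (A n) x / fact n) * moment_fps M X" .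
  \<comment> \<open>Cancelling \<open>?m z\<close> requires it to be nonzero; it is continuous at 0
    with value 1 there.\<close>
  have "isCont ?m 0" using has_fps_expansion_imp_continuous[OF mgf] .
  then have "(?m \<longlongrightarrow> ?m 0) (nhds 0)"
    by (simp add: isCont_def tendsto_nhds_iff)
  then have "\<forall>\<^sub>F z in nhds 0. ?m z \<noteq> 0"
    by (rule tendsto_imp_eventually_ne) (simp add: prob_space)
  then have "\<forall>\<^sub>F z in nhds 0. exp (x * z) / ?m z * ?m z = exp (x * z)"
    by eventually_elim simp
  with prod have "(\<lambda>z. exp (x * z)) has_fps_expansion
      Abs_fps (\<lambda>n. poly (A n) x / fact n) * moment_fps M X"
    unfolding has_fps_expansion_def by (auto elim: eventually_elim2)
  from has_fps_expansion_unique[OF this has_fps_expansion_exp] show ?thesis .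
qed

section \<open>Truncated expansions of the reciprocal series\<close>

lemma fps_nth_mult_power_eq_0:
  fixes c :: "'a::comm_ring_1 fps"
  assumes "fps_nth c 0 = 0" "n < k"
  shows "fps_nth (H * c ^ k) n = 0"
proof -
  have "fps_nth (c ^ k) i = 0" if "i \<le> n" for i
    using startsby_zero_power_prefix[OF assms(1), of k] that assms(2) by simp
  then show ?thesis
    by (simp add: fps_mult_nth)
qed

text \<open>The binomial theorem in the series ring produces these signed coefficients as series;
  identified with constants, they pass through coefficient extraction.\<close>

lemma fps_nth_signed_of_nat_mult:
  fixes F :: "'a::comm_ring_1 fps"
  shows "fps_nth (of_nat c * (-1) ^ k * F) n = of_nat c * (-1) ^ k * fps_nth F n"
proof -
  have "fps_const (of_nat c * (-1) ^ k :: 'a) = fps_const (of_nat c) * fps_const (-1) ^ k"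
    by (simp only: fps_const_mult fps_const_power)
  also have "\<dots> = of_nat c * (-1) ^ k"
    by (simp only: fps_of_nat fps_const_neg[symmetric] fps_const_1_eq_1)
  finally show ?thesis
    by (metis fps_mult_left_const_nth)
qed

text \<open>Here \<open>G\<close> plays the role of \<open>E / a\<close>. The finite geometric sum
  in \<open>1 - a\<close> differs from it by \<open>G * (1 - a) ^ Suc n\<close>, which is invisible
  in degree \<open>n\<close>.\<close>

lemma fps_nth_geometric_sum:
  fixes a E G :: "'a::comm_ring_1 fps"
  assumes "fps_nth a 0 = 1" "G * a = E"
  shows "(\<Sum>r=0..n. (-1) ^ r * fps_nth (E * (a - 1) ^ r) n) = fps_nth G n"
proof -
  have minus: "(1 - a) ^ r = (-1) ^ r * (a - 1) ^ r" for r
    by (simp flip: power_mult_distrib)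
  have "(\<Sum>r=0..n. (-1) ^ r * fps_nth (E * (a - 1) ^ r) n) = (\<Sum>r=0..n. fps_nth (E * (1 - a) ^ r) n)"
    unfolding minus by (rule sum.cong) (auto simp: minus_one_power_iff)
  also have "\<dots> = fps_nth (E * (\<Sum>r<Suc n. (1 - a) ^ r)) n"
    by (simp add: fps_sum_nth sum_distrib_left atLeast0AtMost lessThan_Suc_atMost)
  also have "E * (\<Sum>r<Suc n. (1 - a) ^ r) = G - G * (1 - a) ^ Suc n"
  proof -
    have "a * (\<Sum>r<Suc n. (1 - a) ^ r) = 1 - (1 - a) ^ Suc n"
      using one_diff_power_eq[of "1 - a" "Suc n"] by (simp del: sum.lessThan_Suc power_Suc)
    then show ?thesis
      unfolding assms(2)[symmetric] by (simp only: mult.assoc right_diff_distrib mult_1_right)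
  qed
  finally show ?thesis
    using fps_nth_mult_power_eq_0[of "1 - a" n "Suc n" G] assms(1) by simp
qed

text \<open>Expanding \<open>(1 - a) ^ Suc r\<close>, removing the constant term and dividing by
  \<open>a\<close> leaves the alternating sum. The exponent \<open>Suc r\<close> is chosen so that
  the remainder has no coefficient in degree \<open>r\<close>.\<close>

lemma fps_nth_inverse_binomial_sum:
  fixes a :: "'a::field fps"
  assumes a0: "fps_nth a 0 = 1"
  shows "(\<Sum>k=0..r. of_nat ((r + 1) choose (k + 1)) * (-1) ^ k * fps_nth (a ^ k) r) = fps_nth (inverse a) r"
proof -
  let ?U = "\<Sum>k\<le>r. of_nat (Suc r choose Suc k) * (-1) ^ k * a ^ k"
  have "(1 - a) ^ Suc r = (\<Sum>k\<le>Suc r. of_nat (Suc r choose k) * (- a) ^ k)"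
    using binomial_ring[of "- a" 1 "Suc r"] by simp
  \<comment> \<open>Pulling one factor \<open>- a\<close> out of every nonconstant term shifts the
    lower binomial index to \<open>Suc k\<close>.\<close>
  also have "\<dots> = 1 - a * ?U"
    unfolding sum.atMost_Suc_shift
    by (simp add: sum_distrib_left power_minus[of a] mult_ac flip: sum_negf)
  finally have "a * ?U = 1 - (1 - a) ^ Suc r" by simp
  then have "inverse a * a * ?U = inverse a - inverse a * (1 - a) ^ Suc r"
    by (simp only: mult.assoc right_diff_distrib mult_1_right)
  then have "?U = inverse a - inverse a * (1 - a) ^ Suc r"
    using a0 by (simp add: inverse_mult_eq_1)
  then have "fps_nth ?U r = fps_nth (inverse a) r"
    using fps_nth_mult_power_eq_0[of "1 - a" r "Suc r" "inverse a"] a0 by simp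
  then show ?thesis
    by (simp only: fps_sum_nth atLeast0AtMost fps_nth_signed_of_nat_mult Suc_eq_plus1)
qed

section \<open>Stirling polynomials as coefficients\<close>

text \<open>The expectation for \<open>k\<close> copies is a coefficient of
  \<open>fps_exp x * ?a ^ k\<close>, so the alternating sum over \<open>k\<close> is the binomial
  expansion of \<open>(?a - 1) ^ r\<close>.\<close>

lemma fact_mult_stirling_poly:
  assumes "prob_space M" "all_moments M X"
  shows "fact r * stirling_poly M X n r x = fact n * fps_nth (fps_exp x * (moment_fps M X - 1) ^ r) n"
proof -
  let ?a = "moment_fps M X" and ?P = "iid_space M X"
  have copies: "indep_copies ?P (\<lambda>i \<omega>. \<omega> i) M X"
    using assms by (intro indep_copies_iid_space all_moments_measurable)
  interpret P: prob_space ?P using copies by (simp add: indep_copies_def)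
  have "(\<integral>\<omega>. (x + partial_sum (\<lambda>i \<omega>. \<omega> i) k \<omega>) ^ n \<partial>?P) = fact n * fps_nth (fps_exp x * ?a ^ k) n" for k
    using P.moment_fps_shift[OF all_moments_partial_sum[OF copies assms(2)], of x k]
    by (simp only: integral_power_eq_moment_fps moment_fps_partial_sum[OF copies assms(2)])
  then have "fact r * stirling_poly M X n r x =
      fact n * (\<Sum>k\<le>r. real (r choose k) * (-1) ^ (r - k) * fps_nth (fps_exp x * ?a ^ k) n)"
    by (simp add: stirling_poly_def sum_distrib_left atLeast0AtMost mult_ac)
  also have "(\<Sum>k\<le>r. real (r choose k) * (-1) ^ (r - k) * fps_nth (fps_exp x * ?a ^ k) n)
      = (\<Sum>k\<le>r. fps_nth (fps_exp x * (of_nat (r choose k) * ?a ^ k * (-1) ^ (r - k))) n)"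
    unfolding fps_nth_signed_of_nat_mult[symmetric] by (simp only: mult_ac)
  also have "\<dots> = fps_nth (fps_exp x * (?a - 1) ^ r) n"
    using binomial_ring[of ?a "-1" r] by (simp add: fps_sum_nth sum_distrib_left)
  finally show ?thesis .
qed

section \<open>Comparison of the three expressions\<close>

theorem theorem4:
  fixes m n :: nat
    and w xs :: "nat \<Rightarrow> real" and x :: real
    and M :: "'a measure" and Y :: "nat \<Rightarrow> 'a \<Rightarrow> real"
    and N :: "'b measure" and Z :: "nat \<Rightarrow> nat \<Rightarrow> 'b \<Rightarrow> real"
    and A :: "nat \<Rightarrow> nat \<Rightarrow> real poly"
  assumes "m \<ge> 1"
    and "x = (\<Sum>j=1..m. w j * xs j)"
    and "prob_space M"
    and "prob_space.indep_vars M (\<lambda>_. borel) Y {1..m}"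
    and "\<And>j. j \<in> {1..m} \<Longrightarrow> finite_exp_moment M (Y j)"
    and "\<And>j. j \<in> {1..m} \<Longrightarrow> appell_polys M (Y j) (A j)"
    and "prob_space N"
    and "\<And>j. j \<in> {1..m} \<Longrightarrow> indep_copies N (Z j) M (Y j)"
    and "prob_space.indep_vars N (\<lambda>_. PiM {1..} (\<lambda>_. borel))
           (\<lambda>j \<omega>. \<lambda>l\<in>{1..}. Z j l \<omega>) {1..m}"
  shows "(\<Sum>js\<in>weak_compositions m n.
            multinomial m n js * (\<Prod>j=1..m. w j ^ js j) * (\<Prod>j=1..m. poly (A j (js j)) (xs j)))
         = (\<Sum>r=0..n. (-1) ^ r * fact r * stirling_poly M (\<lambda>\<omega>. \<Sum>j=1..m. w j * Y j \<omega>) n r x)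
       \<and> (\<Sum>r=0..n. (-1) ^ r * fact r * stirling_poly M (\<lambda>\<omega>. \<Sum>j=1..m. w j * Y j \<omega>) n r x)
         = (\<Sum>r=0..n. real (n choose r) * x ^ (n - r) *
             (\<Sum>k=0..r. real ((r + 1) choose (k + 1)) * (-1) ^ k *
               (\<integral>\<omega>. (\<Sum>j=1..m. w j * partial_sum (Z j) k \<omega>) ^ r \<partial>N)))"
proof -
  interpret M: prob_space M by fact
  interpret N: prob_space N by fact
  define W where "W = (\<lambda>\<omega>. \<Sum>j=1..m. w j * Y j \<omega>)"
  define a where "a = moment_fps M W"
  \<comment> \<open>Substituting \<open>w j * z\<close> for \<open>z\<close> puts the factor
    \<open>w j ^ i\<close> on the \<open>i\<close>-th coefficient, as the first expression
    demands.\<close>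
  define G where "G = (\<lambda>j. Abs_fps (\<lambda>i. poly (A j i) (xs j) / fact i) oo (fps_const (w j) * fps_X))"
  have Y_meas: "Y j \<in> borel_measurable M" if "j \<in> {1..m}" for j
    using assms(4) that by (simp add: M.indep_vars_def)
  have Y_mom: "all_moments M (Y j)" if "j \<in> {1..m}" for j
    using all_moments_finite_exp_moment[OF Y_meas assms(5)] that by blast
  have wY_indep: "M.indep_vars (\<lambda>_. borel) (\<lambda>j \<omega>. w j * Y j \<omega>) {1..m}"
    by (rule M.indep_vars_compose2[OF assms(4)]) simp
  have W_mom: "all_moments M W"
    unfolding W_def using Y_mom by (intro M.all_moments_sum_indep wY_indep all_moments_cmult) auto
  have a_prod: "a = (\<Prod>j=1..m. moment_fps M (\<lambda>\<omega>. w j * Y j \<omega>))"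
    unfolding a_def W_def using Y_mom by (intro M.moment_fps_sum_indep wY_indep all_moments_cmult) auto
  have a0: "fps_nth a 0 = 1" unfolding a_def by (rule M.moment_fps_0)

  \<comment> \<open>The same substitution turns the series of \<open>Y j\<close> into that of
    \<open>w j * Y j\<close>, so the Appell identity survives rescaling.\<close>
  have "G j * moment_fps M (\<lambda>\<omega>. w j * Y j \<omega>) = fps_exp (w j * xs j)" if j: "j \<in> {1..m}" for j
  proof -
    have "Abs_fps (\<lambda>i. poly (A j i) (xs j) / fact i) * moment_fps M (Y j) = fps_exp (xs j)"
      using j by (intro appell_polys_mult_moment_fps assms(3) Y_meas assms(5) assms(6))
    then have "G j * moment_fps M (\<lambda>\<omega>. w j * Y j \<omega>) = fps_exp (xs j) oo (fps_const (w j) * fps_X)"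
      unfolding G_def moment_fps_cmult by (simp flip: fps_compose_mult_distrib)
    also have "\<dots> = fps_exp (w j * xs j)"
      by (rule fps_ext) (simp add: fps_nth_compose_linear power_mult_distrib)
    finally show ?thesis .
  qed
  then have "(\<Prod>j=1..m. G j) * a = (\<Prod>j=1..m. fps_exp (w j * xs j))"
    unfolding a_prod by (simp flip: prod.distrib)
  also have "\<dots> = fps_exp x"
    unfolding assms(2) by (induction m) (simp_all add: fps_exp_add_mult)
  finally have G_a: "(\<Prod>j=1..m. G j) * a = fps_exp x" .
  then have G_eq: "(\<Prod>j=1..m. G j) = fps_exp x * inverse a"
    using a0 by (simp add: mult.assoc inverse_mult_eq_1' flip: G_a)

  \<comment> \<open>The factorials in the denominator of \<open>multinomial\<close> are those of the
    exponential generating series.\<close>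
  have "(\<Sum>js\<in>weak_compositions m n.
          multinomial m n js * (\<Prod>j=1..m. w j ^ js j) * (\<Prod>j=1..m. poly (A j (js j)) (xs j)))
      = fact n * fps_nth (\<Prod>j=1..m. G j) n"
    unfolding fps_prod_nth_weak_compositions sum_distrib_left
    by (rule sum.cong)
      (simp_all add: G_def fps_nth_compose_linear multinomial_def prod_dividef prod.distrib)
  moreover have "(\<Sum>r=0..n. (-1) ^ r * fact r * stirling_poly M W n r x) = fact n * fps_nth (\<Prod>j=1..m. G j) n"
    using fps_nth_geometric_sum[OF a0 G_a, of n] fact_mult_stirling_poly[OF assms(3) W_mom]
    by (simp only: mult.assoc mult.left_commute[of _ "fact n"] a_def sum_distrib_left[symmetric])
  moreover have "(\<Sum>r=0..n. real (n choose r) * x ^ (n - r) *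
      (\<Sum>k=0..r. real ((r + 1) choose (k + 1)) * (-1) ^ k *
        (\<integral>\<omega>. (\<Sum>j=1..m. w j * partial_sum (Z j) k \<omega>) ^ r \<partial>N)))
      = fact n * fps_nth (\<Prod>j=1..m. G j) n"
  proof -
    \<comment> \<open>The weighted partial sums have the moments of a sum of \<open>k\<close> copies
      of \<open>W\<close>: exchanging the product over \<open>j\<close> with the \<open>k\<close>-th
      power gives \<open>a ^ k\<close>.\<close>
    have "moment_fps N (\<lambda>\<omega>. \<Sum>j=1..m. w j * partial_sum (Z j) k \<omega>) = a ^ k" for k
    proof -
      \<comment> \<open>The \<open>j\<close>-th partial sum is a measurable function of the whole
        \<open>j\<close>-th sequence, so independence between the sequences passes to it.\<close>
      have "N.indep_vars (\<lambda>_. borel) (\<lambda>j \<omega>. w j * (\<Sum>l=1..k. (\<lambda>l\<in>{1..}. Z j l \<omega>) l)) {1..m}"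
        by (rule N.indep_vars_compose2[OF assms(9), where Y = "\<lambda>j f. w j * (\<Sum>l=1..k. f l)"])
          (intro borel_measurable_times borel_measurable_const borel_measurable_sum
            measurable_component_singleton, auto)
      then have ind: "N.indep_vars (\<lambda>_. borel) (\<lambda>j \<omega>. w j * partial_sum (Z j) k \<omega>) {1..m}"
        by (simp add: partial_sum_def)
      have "moment_fps N (\<lambda>\<omega>. \<Sum>j=1..m. w j * partial_sum (Z j) k \<omega>)
          = (\<Prod>j=1..m. moment_fps N (\<lambda>\<omega>. w j * partial_sum (Z j) k \<omega>))"
        using Y_mom assms(8)
        by (intro N.moment_fps_sum_indep ind all_moments_cmult) (auto intro!: all_moments_partial_sum)
      also have "\<dots> = (\<Prod>j=1..m. moment_fps M (\<lambda>\<omega>. w j * Y j \<omega>) ^ k)"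
        using moment_fps_partial_sum[OF assms(8) Y_mom]
        by (intro prod.cong) (simp_all add: moment_fps_cmult fps_compose_power)
      finally show ?thesis by (simp add: a_prod prod_power_distrib)
    qed
    then have "(\<Sum>k=0..r. real ((r + 1) choose (k + 1)) * (-1) ^ k *
        (\<integral>\<omega>. (\<Sum>j=1..m. w j * partial_sum (Z j) k \<omega>) ^ r \<partial>N)) = fact r * fps_nth (inverse a) r" for r
      by (simp only: integral_power_eq_moment_fps sum_distrib_left mult.left_commute[of _ "fact r"]
          flip: fps_nth_inverse_binomial_sum[OF a0])
    then have "(\<Sum>r=0..n. real (n choose r) * x ^ (n - r) *
        (\<Sum>k=0..r. real ((r + 1) choose (k + 1)) * (-1) ^ k *
          (\<integral>\<omega>. (\<Sum>j=1..m. w j * partial_sum (Z j) k \<omega>) ^ r \<partial>N)))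
        = (\<Sum>r=0..n. real (n choose r) * x ^ (n - r) * (fact r * fps_nth (inverse a) r))"
      by (simp only:)
    \<comment> \<open>The binomial convolution with the powers of \<open>x\<close> is the Cauchy
      product with \<open>fps_exp x\<close>.\<close>
    also have "\<dots> = fact n * fps_nth (inverse a * fps_exp x) n"
      unfolding fps_mult_nth sum_distrib_left
      by (rule sum.cong) (simp_all add: binomial_fact)
    finally show ?thesis by (simp only: G_eq mult.commute[of "inverse a"])
  qed
  ultimately show ?thesis by (simp only: W_def)
qed

end
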